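(* Let $n\geq 2$. The $n$-dimensional augmented cube $AQ_n$ contains at least $$f(n)=1+\sum_{1\leq k\leq n-1}\ \sum_{2\leq j_1<j_2<\cdots<j_k\leq n}(j_k-j_{k-1})\cdots(j_2-j_1)\,j_1$$ distinct subgraphs that are isomorphic to the $n$-dimensional hypercube $Q_n$. (For $k=1$ the product in the summand is just $j_1$.)
   Context: The $n$-dimensional hypercube $Q_n$ has vertex set $\{0,1\}^n$ (strings $x_n x_{n-1}\cdots x_1$), two vertices being adjacent iff they differ in exactly one bit. The $n$-dimensional augmented cube $AQ_n$ has the same vertex set $\{0,1\}^n$, and $u=u_n\cdots u_1$ is adjacent to $v=v_n\cdots v_1$ iff either (i) there is $i\in\{1,\dots,n\}$ with $v_i=u_i+1 \pmod 2$ and $v_l=u_l$ for $l\neq i$ (a hypercube edge of dimension $i$), or (ii) there is $j\in\{2,\dots,n\}$ with $v_l=u_l+1\pmod 2$ for all $l\leq j$ and $v_l=u_l$ for all $l>j$ (an augmented edge of dimension $j$). Thus $AQ_n$ is $(2n-1)$-regular and contains $Q_n$ as a spanning subgraph. Two subgraphs are distinct if they differ as subgraphs (here, equivalently, in their edge sets). *)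

theory Defs
  imports "Graph_Theory.Graph_Theory" "HOL-Library.FuncSet"
begin

text \<open>
  As in \<^theory>\<open>Graph_Theory.Digraph\<close>, a finite simple graph is a symmetric loop-free digraph
  (\<^locale>\<open>pair_graph\<close>): the edge \<open>uv\<close> is the pair of arcs \<open>(u, v)\<close>, \<open>(v, u)\<close>.

  A string \<open>x\<^sub>n \<dots> x\<^sub>1\<close> over \<open>{0, 1}\<close> is the extensional function \<open>i \<mapsto> x\<^sub>i\<close> on \<open>{1..n}\<close>.
\<close>

definition bitstrings :: "nat \<Rightarrow> (nat \<Rightarrow> nat) set" where
  "bitstrings n = {1..n} \<rightarrow>\<^sub>E {0, 1}"

definition hypercube_edge :: "nat \<Rightarrow> nat \<Rightarrow> (nat \<Rightarrow> nat) \<Rightarrow> (nat \<Rightarrow> nat) \<Rightarrow> bool" where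
  "hypercube_edge n i u v \<longleftrightarrow>
     v i = (u i + 1) mod 2 \<and> (\<forall>l\<in>{1..n}. l \<noteq> i \<longrightarrow> v l = u l)"

definition augmented_edge :: "nat \<Rightarrow> nat \<Rightarrow> (nat \<Rightarrow> nat) \<Rightarrow> (nat \<Rightarrow> nat) \<Rightarrow> bool" where
  "augmented_edge n j u v \<longleftrightarrow>
     (\<forall>l\<in>{1..n}. l \<le> j \<longrightarrow> v l = (u l + 1) mod 2) \<and> (\<forall>l\<in>{1..n}. l > j \<longrightarrow> v l = u l)"

definition hypercube :: "nat \<Rightarrow> (nat \<Rightarrow> nat) pair_pre_digraph" where
  "hypercube n =
     \<lparr> pverts = bitstrings n,
       parcs = {(u, v). u \<in> bitstrings n \<and> v \<in> bitstrings n \<and>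
                  (\<exists>i\<in>{1..n}. hypercube_edge n i u v)} \<rparr>"

definition augmented_cube :: "nat \<Rightarrow> (nat \<Rightarrow> nat) pair_pre_digraph" where
  "augmented_cube n =
     \<lparr> pverts = bitstrings n,
       parcs = {(u, v). u \<in> bitstrings n \<and> v \<in> bitstrings n \<and>
                  ((\<exists>i\<in>{1..n}. hypercube_edge n i u v) \<or>
                   (\<exists>j\<in>{2..n}. augmented_edge n j u v))} \<rparr>"

text \<open>
  A sequence \<open>2 \<le> j\<^sub>1 < \<dots> < j\<^sub>k \<le> n\<close> is a strictly increasing extensional function
  \<open>{1..k} \<rightarrow> {2..n}\<close>.  The subtractions \<open>j i - j (i - 1)\<close> therefore never truncate.
\<close>

definition increasing_seqs :: "nat \<Rightarrow> nat \<Rightarrow> (nat \<Rightarrow> nat) set" where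
  "increasing_seqs k n = {j \<in> {1..k} \<rightarrow>\<^sub>E {2..n}. strict_mono_on {1..k} j}"

definition lower_bound :: "nat \<Rightarrow> nat" where
  "lower_bound n = 1 + (\<Sum>k = 1..n - 1. \<Sum>j\<in>increasing_seqs k n.
                (\<Prod>i = 2..k. j i - j (i - 1)) * j 1)"

lemma finite_bitstrings: "finite (bitstrings n)"
  unfolding bitstrings_def by (intro finite_PiE) auto

lemma flip_bit_iff:
  assumes "u \<in> bitstrings n" "v \<in> bitstrings n" "l \<in> {1..n}"
  shows "v l = (u l + 1) mod 2 \<longleftrightarrow> v l \<noteq> u l"
proof -
  have "u l \<in> {0, 1}" "v l \<in> {0, 1}"
    using assms unfolding bitstrings_def by (auto simp only: PiE_iff)
  then show ?thesis by auto
qed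

lemma hypercube_edge_iff:
  assumes "u \<in> bitstrings n" "v \<in> bitstrings n" "i \<in> {1..n}"
  shows "hypercube_edge n i u v \<longleftrightarrow> (\<forall>l\<in>{1..n}. v l \<noteq> u l \<longleftrightarrow> l = i)"
  using flip_bit_iff[OF assms] assms(3) unfolding hypercube_edge_def by blast

lemma augmented_edge_iff:
  assumes "u \<in> bitstrings n" "v \<in> bitstrings n"
  shows "augmented_edge n j u v \<longleftrightarrow> (\<forall>l\<in>{1..n}. v l \<noteq> u l \<longleftrightarrow> l \<le> j)"
proof -
  have "augmented_edge n j u v \<longleftrightarrow>
      (\<forall>l\<in>{1..n}. l \<le> j \<longrightarrow> v l \<noteq> u l) \<and> (\<forall>l\<in>{1..n}. \<not> l \<le> j \<longrightarrow> v l = u l)"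
    unfolding augmented_edge_def not_le by (simp only: flip_bit_iff[OF assms] cong: ball_cong)
  then show ?thesis by blast
qed

lemma hypercube_edge_sym:
  assumes "u \<in> bitstrings n" "v \<in> bitstrings n" "i \<in> {1..n}" "hypercube_edge n i u v"
  shows "hypercube_edge n i v u" "u \<noteq> v"
proof -
  have "\<forall>l\<in>{1..n}. v l \<noteq> u l \<longleftrightarrow> l = i"
    using assms by (simp only: hypercube_edge_iff)
  then show "hypercube_edge n i v u" "u \<noteq> v"
    using assms(3) by (metis hypercube_edge_iff assms(1-3))+
qed

lemma augmented_edge_sym:
  assumes "u \<in> bitstrings n" "v \<in> bitstrings n" "j \<in> {2..n}" "augmented_edge n j u v"
  shows "augmented_edge n j v u" "u \<noteq> v"
proof -
  have *: "\<forall>l\<in>{1..n}. v l \<noteq> u l \<longleftrightarrow> l \<le> j"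
    using assms by (simp only: augmented_edge_iff)
  then show "augmented_edge n j v u"
    by (metis augmented_edge_iff assms(1,2))
  show "u \<noteq> v" using bspec[OF *, of 1] assms(3) by auto
qed

lemma pair_graphI:
  assumes "finite V" "E \<subseteq> V \<times> V" "sym E" "irrefl E"
  shows "pair_graph \<lparr> pverts = V, parcs = E \<rparr>"
proof
  show "finite (parcs \<lparr> pverts = V, parcs = E \<rparr>)"
    using assms(1,2) finite_subset by fastforce
  show "symmetric (with_proj \<lparr> pverts = V, parcs = E \<rparr>)"
    using assms(3) by (simp add: symmetric_def arcs_ends_def arc_to_ends_def with_proj_def)
qed (use assms in \<open>auto simp: irrefl_def\<close>)

lemma pair_graph_hypercube: "pair_graph (hypercube n)"
  unfolding hypercube_def
  by (intro pair_graphI symI irreflI finite_bitstrings)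
     (use hypercube_edge_sym in blast)+

lemma pair_graph_augmented_cube: "pair_graph (augmented_cube n)"
  unfolding augmented_cube_def
  by (intro pair_graphI symI irreflI finite_bitstrings)
     (use hypercube_edge_sym augmented_edge_sym in blast)+

lemma spanning_hypercube:
  "spanning (with_proj (hypercube n)) (with_proj (augmented_cube n))"
proof -
  interpret Q: pair_graph "hypercube n" by (rule pair_graph_hypercube)
  interpret A: pair_graph "augmented_cube n" by (rule pair_graph_augmented_cube)
  show ?thesis
    unfolding spanning_def subgraph_def compatible_def
    using Q.wf_digraph A.wf_digraph
    by (simp add: hypercube_def augmented_cube_def) blast
qed

end

theory Submission
  imports Defs
begin

text \<open>
  Identify \<open>{0, 1}\<^sup>n\<close> with the vector space of subsets of \<open>{1..n}\<close> over the two-element field.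
  Then \<open>AQ\<^sub>n\<close> is the Cayley graph with generators \<open>{i}\<close> (\<open>1 \<le> i \<le> n\<close>) and \<open>{1..j}\<close> (\<open>2 \<le> j \<le> n\<close>),
  and every basis consisting of generators spans a copy of \<open>Q\<^sub>n\<close>; distinct bases give distinct
  edge sets.  Choosing \<open>{1..j\<^sub>1}, \<dots>, {1..j\<^sub>k}\<close> and dropping one singleton \<open>{r\<^sub>i}\<close> from each block
  \<open>j\<^sub>i\<^sub>-\<^sub>1 < r\<^sub>i \<le> j\<^sub>i\<close> (with \<open>j\<^sub>0 = 0\<close>) leaves a basis, and there are
  \<open>j\<^sub>1 (j\<^sub>2 - j\<^sub>1) \<dots> (j\<^sub>k - j\<^sub>k\<^sub>-\<^sub>1)\<close> ways to choose the \<open>r\<^sub>i\<close>.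
\<close>

section \<open>Cayley graphs on bit strings\<close>

definition difference_set :: "nat \<Rightarrow> (nat \<Rightarrow> nat) \<Rightarrow> (nat \<Rightarrow> nat) \<Rightarrow> nat set" where
  "difference_set n u v = {l \<in> {1..n}. u l \<noteq> v l}"

text \<open>The Cayley graph with connection set \<open>B\<close>: over the two-element field,
  \<open>difference_set n u v\<close> is the sum of \<open>u\<close> and \<open>v\<close>.\<close>

definition difference_graph :: "nat \<Rightarrow> nat set set \<Rightarrow> (nat \<Rightarrow> nat) pair_pre_digraph" where
  "difference_graph n B =
     \<lparr> pverts = bitstrings n,
       parcs = {(u, v). u \<in> bitstrings n \<and> v \<in> bitstrings n \<and> difference_set n u v \<in> B} \<rparr>"

definition augmented_generators :: "nat \<Rightarrow> nat set set" where
  "augmented_generators n = (\<lambda>i. {i}) ` {1..n} \<union> (\<lambda>j. {1..j}) ` {2..n}"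

lemma difference_set_commute: "difference_set n u v = difference_set n v u"
  unfolding difference_set_def by auto

lemma difference_set_refl: "difference_set n u u = {}"
  unfolding difference_set_def by auto

lemma bitstrings_eqI:
  assumes "u \<in> bitstrings n" "v \<in> bitstrings n" "difference_set n u v = {}"
  shows "u = v"
  using assms unfolding bitstrings_def difference_set_def by (intro PiE_ext) auto

lemma bitstrings_cases:
  assumes "u \<in> bitstrings n" "l \<in> {1..n}"
  shows "u l = 0 \<or> u l = 1"
proof -
  have "u l \<in> {0, 1}"
    using assms unfolding bitstrings_def by (rule PiE_mem)
  then show ?thesis by simp
qed

lemma difference_set_eq_iff:
  assumes "S \<subseteq> {1..n}"
  shows "difference_set n u v = S \<longleftrightarrow> (\<forall>l\<in>{1..n}. v l \<noteq> u l \<longleftrightarrow> l \<in> S)"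
proof
  assume "difference_set n u v = S"
  then show "\<forall>l\<in>{1..n}. v l \<noteq> u l \<longleftrightarrow> l \<in> S"
    unfolding difference_set_def by auto
next
  assume eq: "\<forall>l\<in>{1..n}. v l \<noteq> u l \<longleftrightarrow> l \<in> S"
  show "difference_set n u v = S"
  proof (rule set_eqI)
    show "l \<in> difference_set n u v \<longleftrightarrow> l \<in> S" for l
      using subsetD[OF assms, of l] bspec[OF eq, of l] unfolding difference_set_def by auto
  qed
qed

lemma hypercube_edge_iff_difference:
  assumes "u \<in> bitstrings n" "v \<in> bitstrings n" "i \<in> {1..n}"
  shows "hypercube_edge n i u v \<longleftrightarrow> difference_set n u v = {i}"
  using assms(3) by (simp add: hypercube_edge_iff[OF assms] difference_set_eq_iff)

lemma augmented_edge_iff_difference: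
  assumes "u \<in> bitstrings n" "v \<in> bitstrings n" "j \<in> {2..n}"
  shows "augmented_edge n j u v \<longleftrightarrow> difference_set n u v = {1..j}"
  using assms(3) by (simp add: augmented_edge_iff[OF assms(1,2)] difference_set_eq_iff)

lemma hypercube_eq: "hypercube n = difference_graph n ((\<lambda>i. {i}) ` {1..n})"
  unfolding hypercube_def difference_graph_def
  by (auto simp: hypercube_edge_iff_difference simp del: atLeastAtMost_iff)

lemma augmented_cube_eq: "augmented_cube n = difference_graph n (augmented_generators n)"
  unfolding augmented_cube_def difference_graph_def augmented_generators_def
  by (auto simp: hypercube_edge_iff_difference augmented_edge_iff_difference
      simp del: atLeastAtMost_iff)

lemma pair_graph_difference_graph:
  assumes "{} \<notin> B"
  shows "pair_graph (difference_graph n B)"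
  unfolding difference_graph_def using assms
  by (intro pair_graphI symI irreflI finite_bitstrings)
     (auto simp: difference_set_refl difference_set_commute)

lemma subgraph_difference_graph:
  assumes "{} \<notin> C" "B \<subseteq> C"
  shows "subgraph (with_proj (difference_graph n B)) (with_proj (difference_graph n C))"
proof -
  interpret B: pair_graph "difference_graph n B"
    using assms by (intro pair_graph_difference_graph) auto
  interpret C: pair_graph "difference_graph n C"
    using assms by (intro pair_graph_difference_graph)
  show ?thesis
    unfolding subgraph_def compatible_def
    using B.wf_digraph C.wf_digraph assms(2) by (auto simp: difference_graph_def)
qed

lemma difference_graph_inj: "inj_on (difference_graph n) (Pow (Pow {1..n}))"
proof (rule inj_onI)
  have sub: "B \<subseteq> C"
    if "B \<subseteq> Pow {1..n}" and eq: "difference_graph n B = difference_graph n C" for B C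
  proof
    fix S assume S: "S \<in> B"
    \<comment> \<open>The zero string and the indicator of \<open>S\<close> differ exactly on
      \<open>S\<close>, so their arc detects whether \<open>S\<close> is a generator.\<close>
    define u v :: "nat \<Rightarrow> nat"
      where "u = (\<lambda>l\<in>{1..n}. 0)" and "v = (\<lambda>l\<in>{1..n}. of_bool (l \<in> S))"
    have uv: "u \<in> bitstrings n" "v \<in> bitstrings n"
      unfolding u_def v_def bitstrings_def by auto
    have diff: "difference_set n u v = S"
      using subsetD[OF that(1) S] unfolding u_def v_def difference_set_def by auto
    have "(u, v) \<in> parcs (difference_graph n B)"
      using uv diff S by (simp add: difference_graph_def)
    then show "S \<in> C"
      unfolding eq using diff by (simp add: difference_graph_def)
  qed
  fix B C
  assume "B \<in> Pow (Pow {1..n})" "C \<in> Pow (Pow {1..n})"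
    "difference_graph n B = difference_graph n C"
  then show "B = C"
    using sub[of B C] sub[of C B] by auto
qed

section \<open>Linear maps over the two-element field\<close>

text \<open>The iterated symmetric difference of the sets \<open>b i\<close> for \<open>i\<close> in
  \<open>D\<close>, that is, their vector sum.\<close>

definition parity_sum :: "nat \<Rightarrow> (nat \<Rightarrow> nat set) \<Rightarrow> nat set \<Rightarrow> nat set" where
  "parity_sum n b D = {l \<in> {1..n}. odd (card {i \<in> D. l \<in> b i})}"

text \<open>The linear map taking the \<open>i\<close>-th unit vector to \<open>b i\<close>, written
  on strings instead of subsets.\<close>

definition linear_image :: "nat \<Rightarrow> (nat \<Rightarrow> nat set) \<Rightarrow> (nat \<Rightarrow> nat) \<Rightarrow> nat \<Rightarrow> nat" where
  "linear_image n b u = (\<lambda>l\<in>{1..n}. card {i \<in> {1..n}. u i = 1 \<and> l \<in> b i} mod 2)"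

lemma even_card_sym_diff:
  assumes "finite A" "finite B"
  shows "even (card ((A - B) \<union> (B - A))) \<longleftrightarrow> (even (card A) \<longleftrightarrow> even (card B))"
proof -
  have "card A = card (A - B) + card (A \<inter> B)" "card B = card (B - A) + card (A \<inter> B)"
    using assms by (metis add.commute card_Int_Diff, metis add.commute card_Int_Diff Int_commute)
  moreover have "card ((A - B) \<union> (B - A)) = card (A - B) + card (B - A)"
    using assms by (intro card_Un_disjoint) auto
  ultimately show ?thesis by auto
qed

lemma linear_image_bitstrings: "linear_image n b u \<in> bitstrings n"
  unfolding linear_image_def bitstrings_def by auto

text \<open>This is linearity: the sum of two images is the image of the sum. At each coordinate it
  reduces to the additivity of parity under symmetric difference.\<close>

lemma difference_set_linear_image:
  assumes "u \<in> bitstrings n" "v \<in> bitstrings n"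
  shows "difference_set n (linear_image n b u) (linear_image n b v) =
    parity_sum n b (difference_set n u v)"
proof -
  have "linear_image n b u l \<noteq> linear_image n b v l \<longleftrightarrow>
      odd (card {i \<in> difference_set n u v. l \<in> b i})" if "l \<in> {1..n}" for l
  proof -
    let ?U = "\<lambda>u. {i \<in> {1..n}. u i = 1 \<and> l \<in> b i}"
    have "{i \<in> difference_set n u v. l \<in> b i} = (?U u - ?U v) \<union> (?U v - ?U u)"
      using bitstrings_cases[OF assms(1)] bitstrings_cases[OF assms(2)]
      unfolding difference_set_def by fastforce
    then show ?thesis
      using that even_card_sym_diff[of "?U u" "?U v"]
      by (auto simp: linear_image_def mod2_eq_if)
  qed
  then show ?thesis
    unfolding difference_set_def[of n "linear_image n b u"] parity_sum_def by blast
qed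

lemma parity_sum_empty: "parity_sum n b {} = {}"
  unfolding parity_sum_def by simp

lemma parity_sum_singleton:
  assumes "b i \<subseteq> {1..n}"
  shows "parity_sum n b {i} = b i"
proof -
  have "{i' \<in> {i}. l \<in> b i'} = (if l \<in> b i then {i} else {})" for l by auto
  then show ?thesis using assms unfolding parity_sum_def by auto
qed

section \<open>Isomorphisms onto the hypercube\<close>

text \<open>Arcs of a pair digraph are pairs of vertices, so the vertex bijection \<open>f\<close>
  forces the arc map \<open>map_prod f f\<close>.\<close>

lemma digraph_iso_with_projI:
  assumes "pair_graph G"
    and bij: "bij_betw f (pverts G) (pverts H)"
    and arcs: "parcs H \<subseteq> pverts H \<times> pverts H"
      "\<And>u v. u \<in> pverts G \<Longrightarrow> v \<in> pverts G \<Longrightarrow> (f u, f v) \<in> parcs H \<longleftrightarrow> (u, v) \<in> parcs G"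
  shows "digraph_iso (with_proj G) (with_proj H)"
proof -
  interpret pair_graph G by fact
  let ?h = "\<lparr> iso_verts = f, iso_arcs = map_prod f f, iso_head = snd, iso_tail = fst \<rparr>"
  have in_verts: "parcs G \<subseteq> pverts G \<times> pverts G"
    using in_arcsD1 in_arcsD2 by auto
  have "inj_on (map_prod f f) (parcs G)"
    using map_prod_inj_on bij in_verts unfolding bij_betw_def by (metis inj_on_subset)
  then have "pre_digraph.digraph_isomorphism (with_proj G) ?h"
    using bij wf_digraph unfolding pre_digraph.digraph_isomorphism_def bij_betw_def by auto
  moreover have "parcs H = map_prod f f ` parcs G"
  proof (intro equalityI subsetI)
    fix e assume e: "e \<in> parcs H"
    then have "e \<in> f ` pverts G \<times> f ` pverts G"
      using arcs(1) bij_betw_imp_surj_on[OF bij] by auto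
    then obtain u v where "e = (f u, f v)" "u \<in> pverts G" "v \<in> pverts G"
      by (elim SigmaE imageE) simp
    then show "e \<in> map_prod f f ` parcs G"
      using arcs(2) e by (auto intro: rev_image_eqI)
  qed (use in_verts arcs(2) in auto)
  then have "with_proj H = app_iso ?h (with_proj G)"
    using bij unfolding app_iso_def bij_betw_def by (simp add: with_proj_def)
  ultimately show ?thesis
    unfolding digraph_iso_def by blast
qed

text \<open>Injectivity of \<open>parity_sum\<close> is linear independence of the
  \<open>b i\<close>. The linear map is then a bijection of the strings, and it turns edges of
  dimension \<open>i\<close> into edges with difference \<open>b i\<close>.\<close>

lemma digraph_iso_hypercubeI:
  assumes b: "\<And>i. i \<in> {1..n} \<Longrightarrow> b i \<subseteq> {1..n}"
    and inj: "inj_on (parity_sum n b) (Pow {1..n})"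
  shows "digraph_iso (with_proj (difference_graph n (b ` {1..n}))) (with_proj (hypercube n))"
proof -
  let ?G = "difference_graph n (b ` {1..n})" and ?M = "linear_image n b"
  have D: "difference_set n u v \<in> Pow {1..n}" for u v
    unfolding difference_set_def by auto
  have diff: "difference_set n (?M u) (?M v) = b i \<longleftrightarrow> difference_set n u v = {i}"
    if "u \<in> bitstrings n" "v \<in> bitstrings n" "i \<in> {1..n}" for u v i
    using that inj_on_eq_iff[OF inj D[of u v], of "{i}"] parity_sum_singleton[of b i n, OF b]
    by (simp add: difference_set_linear_image)
  have inj_M: "inj_on ?M (bitstrings n)"
  proof (rule inj_onI)
    fix u v assume uv: "u \<in> bitstrings n" "v \<in> bitstrings n" "?M u = ?M v"
    then have "parity_sum n b (difference_set n u v) = parity_sum n b {}"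
      by (metis difference_set_linear_image difference_set_refl parity_sum_empty)
    then have "difference_set n u v = {}"
      using inj_onD[OF inj _ D] by simp
    then show "u = v"
      using uv(1,2) by (intro bitstrings_eqI)
  qed
  \<comment> \<open>An injective self-map of a finite set is onto.\<close>
  then have bij: "bij_betw ?M (bitstrings n) (bitstrings n)"
    using endo_inj_surj[OF finite_bitstrings _ inj_M] linear_image_bitstrings
    unfolding bij_betw_def by blast
  \<comment> \<open>An independent family has no zero vector; this keeps the graph
    loop-free.\<close>
  have "b i \<noteq> {}" if "i \<in> {1..n}" for i
    using inj_on_eq_iff[OF inj, of "{}" "{i}"] that parity_sum_singleton[of b i n, OF b]
    by (simp add: parity_sum_empty)
  then have "pair_graph ?G"
    by (intro pair_graph_difference_graph) (metis imageE)
  then show ?thesis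
  proof (rule digraph_iso_with_projI)
    \<comment> \<open>The inverse appears because the isomorphism runs towards the hypercube, while
      \<open>linear_image\<close> runs away from it.\<close>
    show "bij_betw (inv_into (bitstrings n) ?M) (pverts ?G) (pverts (hypercube n))"
      using bij_betw_inv_into[OF bij] by (simp add: difference_graph_def hypercube_def)
    show "parcs (hypercube n) \<subseteq> pverts (hypercube n) \<times> pverts (hypercube n)"
      by (auto simp: hypercube_def)
    fix u v assume "u \<in> pverts ?G" "v \<in> pverts ?G"
    then have "u \<in> bitstrings n" "v \<in> bitstrings n" by (auto simp: difference_graph_def)
    then obtain u' v' where u'v': "u = ?M u'" "v = ?M v'" "u' \<in> bitstrings n" "v' \<in> bitstrings n"
      using bij unfolding bij_betw_def by blast
    show "(inv_into (bitstrings n) ?M u, inv_into (bitstrings n) ?M v) \<in> parcs (hypercube n) \<longleftrightarrow>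
        (u, v) \<in> parcs ?G"
      using u'v' diff
      by (auto simp: hypercube_eq difference_graph_def linear_image_bitstrings
          inv_into_f_f[OF inj_M] image_iff simp del: atLeastAtMost_iff)
  qed
qed

text \<open>The hypothesis says that the incidence matrix of \<open>b\<close> is unitriangular after sorting by \<open>\<rho>\<close>.\<close>

lemma parity_sum_inj:
  fixes \<rho> :: "nat \<Rightarrow> nat"
  assumes refl: "\<And>i. i \<in> {1..n} \<Longrightarrow> i \<in> b i"
    and rank: "\<And>i i'. \<lbrakk>i \<in> {1..n}; i' \<in> {1..n}; i \<in> b i'; i' \<noteq> i\<rbrakk> \<Longrightarrow> \<rho> i' < \<rho> i"
  shows "inj_on (parity_sum n b) (Pow {1..n})"
proof (rule inj_onI)
  fix D E assume DE: "D \<in> Pow {1..n}" "E \<in> Pow {1..n}" and eq: "parity_sum n b D = parity_sum n b E"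
  have "i \<in> D \<longleftrightarrow> i \<in> E" if "i \<in> {1..n}" for i
    using that
  proof (induction "\<rho> i" arbitrary: i rule: less_induct)
    case less
    define A where "A = (\<lambda>D. {i' \<in> D. i \<in> b i'})"
    have fin: "finite (A D)" "finite (A E)"
      using DE finite_subset unfolding A_def by fastforce+
    have "i \<in> parity_sum n b D \<longleftrightarrow> i \<in> parity_sum n b E"
      using eq by simp
    then have "even (card ((A D - A E) \<union> (A E - A D)))"
      using less.prems even_card_sym_diff[OF fin] by (simp add: parity_sum_def A_def)
    \<comment> \<open>Any other \<open>i'\<close> with \<open>i\<close> in \<open>b i'\<close> has
      smaller rank, so by induction it lies in both \<open>D\<close> and \<open>E\<close> or in
      neither. What remains is a subset of \<open>{i}\<close> of even size, hence empty.\<close>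
    moreover have "(A D - A E) \<union> (A E - A D) \<subseteq> {i}"
      using DE rank[OF less.prems] less.hyps unfolding A_def by blast
    ultimately have "(A D - A E) \<union> (A E - A D) = {}"
      by (metis subset_singletonD card.empty is_singletonI is_singleton_altdef odd_one)
    then show ?case
      using refl[OF less.prems] unfolding A_def by blast
  qed
  then show "D = E" using DE by blast
qed

section \<open>Counting the choices of prefixes and dropped singletons\<close>

text \<open>The first block is treated separately because an extensional \<open>j\<close> on
  \<open>{1..k}\<close> has \<open>j 0 = undefined\<close>, not the conventional value 0.\<close>

definition block_choices :: "nat \<Rightarrow> (nat \<Rightarrow> nat) \<Rightarrow> (nat \<Rightarrow> nat) set" where
  "block_choices k j = (\<Pi>\<^sub>E i\<in>{1..k}. {if i = 1 then 1 else j (i - 1) + 1..j i})"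

definition basis_data :: "nat \<Rightarrow> (nat \<times> (nat \<Rightarrow> nat) \<times> (nat \<Rightarrow> nat)) set" where
  "basis_data n = (SIGMA k:{0..n - 1}. SIGMA j:increasing_seqs k n. block_choices k j)"

definition basis_of :: "nat \<Rightarrow> nat \<times> (nat \<Rightarrow> nat) \<times> (nat \<Rightarrow> nat) \<Rightarrow> nat set set" where
  "basis_of n = (\<lambda>(k, j, r). (\<lambda>m. {1..j m}) ` {1..k} \<union> (\<lambda>i. {i}) ` ({1..n} - r ` {1..k}))"

lemma finite_increasing_seqs: "finite (increasing_seqs k n)"
proof (rule finite_subset)
  show "increasing_seqs k n \<subseteq> {1..k} \<rightarrow>\<^sub>E {2..n}"
    unfolding increasing_seqs_def by blast
qed (intro finite_PiE, auto)

lemma finite_block_choices: "finite (block_choices k j)"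
  unfolding block_choices_def by (intro finite_PiE) auto

lemma card_block_choices:
  assumes "k \<ge> 1"
  shows "card (block_choices k j) = (\<Prod>i = 2..k. j i - j (i - 1)) * j 1"
proof -
  have "card (block_choices k j) = (\<Prod>i = 1..k. j i - (if i = 1 then 0 else j (i - 1)))"
    unfolding block_choices_def by (subst card_PiE) (auto intro!: prod.cong)
  also have "\<dots> = j 1 * (\<Prod>i = 2..k. j i - (if i = 1 then 0 else j (i - 1)))"
    using assms by (subst prod.atLeast_Suc_atMost) (auto simp: numeral_2_eq_2)
  also have "\<dots> = j 1 * (\<Prod>i = 2..k. j i - j (i - 1))"
    by (auto intro!: prod.cong)
  finally show ?thesis by (simp add: mult.commute)
qed

lemma card_basis_data: "card (basis_data n) = lower_bound n"
proof -
  have "card (basis_data n) =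
      (\<Sum>k = 0..n - 1. \<Sum>j\<in>increasing_seqs k n. card (block_choices k j))"
    unfolding basis_data_def
    by (simp add: card_SigmaI finite_SigmaI finite_increasing_seqs finite_block_choices)
  also have "\<dots> = (\<Sum>j\<in>increasing_seqs 0 n. card (block_choices 0 j)) +
      (\<Sum>k = 1..n - 1. \<Sum>j\<in>increasing_seqs k n. card (block_choices k j))"
    by (subst sum.atLeast_Suc_atMost) auto
  \<comment> \<open>For \<open>k = 0\<close> only the empty sequence with the empty choice exists.
    It stands for the standard basis and gives the summand 1.\<close>
  also have "(\<Sum>j\<in>increasing_seqs 0 n. card (block_choices 0 j)) = 1"
    by (simp add: increasing_seqs_def block_choices_def strict_mono_on_def)
  finally show ?thesis
    unfolding lower_bound_def by (simp add: card_block_choices)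
qed

section \<open>From choices to bases\<close>

lemma increasing_seqsD:
  assumes "j \<in> increasing_seqs k n"
  shows "\<And>m. m \<in> {1..k} \<Longrightarrow> j m \<in> {2..n}"
    and "\<And>m m'. m \<in> {1..k} \<Longrightarrow> m' \<in> {1..k} \<Longrightarrow> m < m' \<Longrightarrow> j m < j m'"
proof -
  have j: "j \<in> {1..k} \<rightarrow>\<^sub>E {2..n}" "strict_mono_on {1..k} j"
    using assms unfolding increasing_seqs_def by simp_all
  show "j m \<in> {2..n}" if "m \<in> {1..k}" for m
    using PiE_mem[OF j(1) that] .
  show "j m < j m'" if "m \<in> {1..k}" "m' \<in> {1..k}" "m < m'" for m m'
    using strict_mono_onD[OF j(2) that] .
qed

text \<open>The blocks are consecutive, so the dropped singletons interlace the chosen prefixes.\<close>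

lemma block_choices_bounds:
  assumes j: "j \<in> increasing_seqs k n" and r: "r \<in> block_choices k j"
  shows block_choices_pos: "\<And>m. m \<in> {1..k} \<Longrightarrow> 1 \<le> r m"
    and block_choices_le: "\<And>m. m \<in> {1..k} \<Longrightarrow> r m \<le> j m"
    and block_choices_gt: "\<And>m m'. m \<in> {1..k} \<Longrightarrow> m' \<in> {1..k} \<Longrightarrow> m < m' \<Longrightarrow> j m < r m'"
proof -
  have mem: "r m \<in> {if m = 1 then 1 else j (m - 1) + 1..j m}" if "m \<in> {1..k}" for m
    using r that unfolding block_choices_def by (rule PiE_mem)
  show "1 \<le> r m" "r m \<le> j m" if "m \<in> {1..k}" for m
    using mem[OF that] by (auto split: if_splits)
  show "j m < r m'" if "m \<in> {1..k}" "m' \<in> {1..k}" "m < m'" for m m'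
  proof -
    \<comment> \<open>Block \<open>m'\<close> starts just above \<open>j (m' - 1)\<close>, so it
      suffices to compare with the preceding prefix.\<close>
    have "j m \<le> j (m' - 1)"
      using increasing_seqsD(2)[OF j, of m "m' - 1"] that
      by (cases "m = m' - 1") fastforce+
    then show ?thesis using mem[OF that(2)] that by auto
  qed
qed

text \<open>Used twice: \<open>r\<close> is injective, and it is determined by its set of
  values.\<close>

lemma strict_mono_on_block_choices:
  assumes "j \<in> increasing_seqs k n" "r \<in> block_choices k j"
  shows "strict_mono_on {1..k} r"
proof (rule strict_mono_onI)
  fix m m' assume m: "m \<in> {1..k}" "m' \<in> {1..k}" "m < m'"
  show "r m < r m'"
    using block_choices_le[OF assms m(1)] block_choices_gt[OF assms m] by linarith
qed

text \<open>In the standard basis each dropped \<open>{r m}\<close> is exchanged for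
  \<open>{1..j m}\<close>, which contains \<open>r m\<close>. Interlacing makes the exchange
  unitriangular, so independence survives.\<close>

lemma basis_of_iso:
  assumes "d \<in> basis_data n"
  shows "digraph_iso (with_proj (difference_graph n (basis_of n d))) (with_proj (hypercube n))"
proof -
  obtain k j r where d: "d = (k, j, r)" and j: "j \<in> increasing_seqs k n" and r: "r \<in> block_choices k j"
    using assms unfolding basis_data_def by auto
  note pos = block_choices_pos[OF j r] and le = block_choices_le[OF j r]
    and gt = block_choices_gt[OF j r]
  have inj_r: "inj_on r {1..k}"
    using strict_mono_on_block_choices[OF j r] by (rule strict_mono_on_imp_inj_on)
  have r_range: "r m \<in> {1..n}" if "m \<in> {1..k}" for m
    using pos[OF that] le[OF that] increasing_seqsD(1)[OF j that] by auto
  \<comment> \<open>Indexes the basis by coordinates: slot \<open>r m\<close> receives its prefix,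
    with \<open>m\<close> recovered by \<open>inv_into\<close>, and every other slot keeps its
    singleton.\<close>
  define b where
    "b = (\<lambda>i. if i \<in> r ` {1..k} then {1..j (inv_into {1..k} r i)} else {i})"
  have b_r: "b (r m) = {1..j m}" if "m \<in> {1..k}" for m
    unfolding b_def using that inv_into_f_f[OF inj_r that] by simp
  have b_other: "b i = {i}" if "i \<notin> r ` {1..k}" for i
    unfolding b_def using that by simp
  have "{1..n} = r ` {1..k} \<union> ({1..n} - r ` {1..k})"
    using r_range by blast
  then have "b ` {1..n} = b ` r ` {1..k} \<union> b ` ({1..n} - r ` {1..k})"
    by (metis image_Un)
  also have "\<dots> = basis_of n d"
    unfolding d basis_of_def using b_r b_other by (simp add: image_image)
  finally have basis: "b ` {1..n} = basis_of n d" .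
  have sub: "b i \<subseteq> {1..n}" if "i \<in> {1..n}" for i
  proof (cases "i \<in> r ` {1..k}")
    case True
    then obtain m where m: "m \<in> {1..k}" "i = r m" by blast
    show ?thesis
      using increasing_seqsD(1)[OF j m(1)] unfolding m(2) b_r[OF m(1)] by auto
  qed (use that b_other in simp)
  \<comment> \<open>Only vectors in dropped slots contain foreign coordinates, and the dropped ones
    among these are smaller. So the rank decreases along dropped coordinates, and kept coordinates
    get the top value \<open>n\<close>.\<close>
  have "inj_on (parity_sum n b) (Pow {1..n})"
  proof (rule parity_sum_inj[where \<rho> = "\<lambda>i. if i \<in> r ` {1..k} then n - i else n"])
    show "i \<in> b i" if "i \<in> {1..n}" for i
    proof (cases "i \<in> r ` {1..k}")
      case True
      then obtain m where m: "m \<in> {1..k}" "i = r m" by blast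
      show ?thesis
        using pos[OF m(1)] le[OF m(1)] unfolding m(2) b_r[OF m(1)] by auto
    qed (use b_other in simp)
    fix i i' assume i: "i \<in> {1..n}" "i' \<in> {1..n}" "i \<in> b i'" "i' \<noteq> i"
    then have i': "i' \<in> r ` {1..k}" using b_other[of i'] by (metis singletonD)
    then obtain m' where m': "m' \<in> {1..k}" "i' = r m'" by blast
    have "i < i'" if i_r: "i \<in> r ` {1..k}"
    proof -
      obtain m where m: "m \<in> {1..k}" "i = r m" using i_r by blast
      have "r m \<le> j m'" using i(3) unfolding m(2) m'(2) b_r[OF m'(1)] by simp
      \<comment> \<open>If \<open>m' < m\<close>, then \<open>r m\<close> would lie beyond the
        prefix \<open>{1..j m'}\<close>.\<close>
      then have "m < m'"
        using gt[OF m'(1) m(1)] i(4) m(2) m'(2) by (cases m m' rule: linorder_cases) auto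
      then show ?thesis
        using gt[OF m(1) m'(1)] le[OF m(1)] m(2) m'(2) by simp
    qed
    then show "(if i' \<in> r ` {1..k} then n - i' else n) < (if i \<in> r ` {1..k} then n - i else n)"
      using i i' by auto
  qed
  then show ?thesis
    using digraph_iso_hypercubeI[of n b, OF sub] unfolding basis by blast
qed

lemma basis_of_subset:
  assumes "d \<in> basis_data n"
  shows "basis_of n d \<subseteq> augmented_generators n"
  using assms increasing_seqsD(1)
  unfolding basis_data_def basis_of_def augmented_generators_def by fastforce

section \<open>Recovering the choices from the basis\<close>

text \<open>A finite set has only one strictly sorted enumeration, and both value lists are such
  enumerations.\<close>

lemma strict_mono_on_image_unique:
  fixes f g :: "nat \<Rightarrow> nat"
  assumes "strict_mono_on {1..k} f" "strict_mono_on {1..k} g" "f ` {1..k} = g ` {1..k}" "i \<in> {1..k}"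
  shows "f i = g i"
proof -
  have sorted: "sorted_wrt (<) (map h [1..<Suc k])" if "strict_mono_on {1..k} h" for h :: "nat \<Rightarrow> nat"
    using that unfolding sorted_wrt_map
    by (intro sorted_wrt_mono_rel[OF _ sorted_wrt_upt])
      (auto intro!: strict_mono_onD[OF that] simp del: upt_Suc)
  have "map f [1..<Suc k] = map g [1..<Suc k]"
    using assms(3)
    by (intro strict_sorted_equal sorted assms(1,2))
      (simp add: atLeastLessThanSuc_atLeastAtMost del: upt_Suc)
  then show ?thesis using assms(4) by (simp del: upt_Suc)
qed

text \<open>Lets prefixes and singletons be told apart inside a basis; at length 1 they would
  coincide.\<close>

lemma singleton_neq_prefix:
  fixes i x :: nat
  assumes "2 \<le> x"
  shows "{i} \<noteq> {1..x}"
proof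
  assume "{i} = {1..x}"
  then have "{1..x} = {i}" by (rule sym)
  then show False using assms by simp
qed

lemma basis_of_prefixes:
  assumes "(k, j, r) \<in> basis_data n"
  shows "{x. 2 \<le> x \<and> {1..x} \<in> basis_of n (k, j, r)} = j ` {1..k}"
proof -
  have j: "j \<in> increasing_seqs k n" using assms unfolding basis_data_def by simp
  have "{1..x} = {1..y} \<longleftrightarrow> x = y" if "2 \<le> x" for x y :: nat
    using that by (auto simp: atLeastatMost_empty_iff Icc_eq_Icc)
  then show ?thesis
    using increasing_seqsD(1)[OF j] singleton_neq_prefix unfolding basis_of_def by fastforce
qed

lemma basis_of_singletons:
  assumes "(k, j, r) \<in> basis_data n"
  shows "{i \<in> {1..n}. {i} \<notin> basis_of n (k, j, r)} = r ` {1..k}"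
proof -
  have j: "j \<in> increasing_seqs k n" and r: "r \<in> block_choices k j"
    using assms unfolding basis_data_def by simp_all
  have "{i} \<noteq> {1..j m}" if "m \<in> {1..k}" for m i
    using increasing_seqsD(1)[OF j that] by (intro singleton_neq_prefix) simp
  moreover have "r m \<in> {1..n}" if "m \<in> {1..k}" for m
    using block_choices_pos[OF j r that] block_choices_le[OF j r that] increasing_seqsD(1)[OF j that]
    by auto
  ultimately show ?thesis
    unfolding basis_of_def by (auto 0 3 simp del: atLeastAtMost_iff)
qed

text \<open>The prefixes in a basis reveal the values of \<open>j\<close>, and the missing
  singletons those of \<open>r\<close>. Monotonicity then fixes the order of the values.\<close>

lemma basis_of_inj: "inj_on (basis_of n) (basis_data n)"
proof (rule inj_onI)
  fix d d' assume d: "d \<in> basis_data n" and d': "d' \<in> basis_data n"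
    and eq: "basis_of n d = basis_of n d'"
  obtain k j r k' j' r' where dd': "d = (k, j, r)" "d' = (k', j', r')"
    by (metis prod_cases3)
  have j: "j \<in> increasing_seqs k n" "j' \<in> increasing_seqs k' n"
    and r: "r \<in> block_choices k j" "r' \<in> block_choices k' j'"
    using d d' unfolding dd' basis_data_def by simp_all
  have mono: "strict_mono_on {1..k} j" "strict_mono_on {1..k'} j'"
    using j unfolding increasing_seqs_def by auto
  have J: "j ` {1..k} = j' ` {1..k'}"
    using basis_of_prefixes[of k j r n] basis_of_prefixes[of k' j' r' n] d d' eq
    unfolding dd' by simp
  have R: "r ` {1..k} = r' ` {1..k'}"
    using basis_of_singletons[of k j r n] basis_of_singletons[of k' j' r' n] d d' eq
    unfolding dd' by simp
  \<comment> \<open>The length of the sequence is the number of its values.\<close>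
  have "card (j ` {1..k}) = k" "card (j' ` {1..k'}) = k'"
    using mono[THEN strict_mono_on_imp_inj_on, THEN card_image] by simp_all
  then have k: "k' = k" using J by simp
  have agree: "j i = j' i" "r i = r' i" if i: "i \<in> {1..k}" for i
  proof -
    show "j i = j' i"
      using strict_mono_on_image_unique[of k j j' i] mono J i unfolding k by simp
    show "r i = r' i"
      using strict_mono_on_image_unique[of k r r' i] R i
        strict_mono_on_block_choices[OF j(1) r(1)] strict_mono_on_block_choices[OF j(2) r(2)]
      unfolding k by simp
  qed
  have "j \<in> {1..k} \<rightarrow>\<^sub>E {2..n}" "j' \<in> {1..k} \<rightarrow>\<^sub>E {2..n}"
    using j unfolding k increasing_seqs_def by simp_all
  then have jj': "j = j'"
    using agree(1) by (rule PiE_ext)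
  have "r = r'"
    using r agree(2) unfolding k jj' block_choices_def by (rule PiE_ext)
  with jj' show "d = d'" unfolding dd' k by simp
qed

section \<open>Counting the subgraphs\<close>

text \<open>Needed because \<open>card\<close> is 0 on infinite sets, so a lower bound on it
  requires finiteness.\<close>

lemma finite_subgraphs:
  assumes "pair_graph G"
  shows "finite {H :: 'a pair_pre_digraph. subgraph (with_proj H) (with_proj G)}"
proof -
  interpret pair_graph G by fact
  have "{H. subgraph (with_proj H) (with_proj G)} \<subseteq>
      (\<lambda>(V, E). \<lparr> pverts = V, parcs = E \<rparr>) ` (Pow (pverts G) \<times> Pow (parcs G))"
  proof
    fix H assume "H \<in> {H. subgraph (with_proj H) (with_proj G)}"
    then show "H \<in> (\<lambda>(V, E). \<lparr> pverts = V, parcs = E \<rparr>) ` (Pow (pverts G) \<times> Pow (parcs G))"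
      by (intro image_eqI[of _ _ "(pverts H, parcs H)"]) (auto simp: subgraph_def)
  qed
  then show ?thesis
    using finite_subset by (fastforce simp: pair_finite_verts pair_finite_arcs)
qed

theorem theorem3p1:
  fixes n :: nat
  assumes "n \<ge> 2"
  shows "lower_bound n \<le> card {H :: (nat \<Rightarrow> nat) pair_pre_digraph.
    pair_graph H \<and>
    subgraph (with_proj H) (with_proj (augmented_cube n)) \<and>
    digraph_iso (with_proj H) (with_proj (hypercube n))}"
    (is "_ \<le> card ?S")
proof -
  have generators: "{} \<notin> augmented_generators n" "augmented_generators n \<subseteq> Pow {1..n}"
    unfolding augmented_generators_def by auto
  have "basis_of n ` basis_data n \<subseteq> Pow (Pow {1..n})"
    using basis_of_subset generators(2) by blast
  \<comment> \<open>Choices determine bases and bases determine edge sets injectively, so distinct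
    choices give distinct subgraphs.\<close>
  then have "inj_on (difference_graph n \<circ> basis_of n) (basis_data n)"
    using comp_inj_on[OF basis_of_inj inj_on_subset[OF difference_graph_inj]] by blast
  then have "lower_bound n = card ((difference_graph n \<circ> basis_of n) ` basis_data n)"
    using card_image card_basis_data by metis
  also have "\<dots> \<le> card ?S"
  proof (rule card_mono)
    show "finite ?S"
      using finite_subgraphs[OF pair_graph_augmented_cube] by (rule rev_finite_subset) blast
    have "difference_graph n (basis_of n d) \<in> ?S" if d: "d \<in> basis_data n" for d
    proof -
      note sub = basis_of_subset[OF d]
      show ?thesis
        using pair_graph_difference_graph[of "basis_of n d" n]
          subgraph_difference_graph[OF generators(1) sub, of n] basis_of_iso[OF d] generators(1) sub
        unfolding augmented_cube_eq by blast
    qed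
    then show "(difference_graph n \<circ> basis_of n) ` basis_data n \<subseteq> ?S" by auto
  qed
  finally show ?thesis .
qed

end
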